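(* For the two-dimensional Euler equations, consider the two-point numerical fluxes $$f^{x}_{\rho}=(\gamma-1)\left(\frac{\gamma}{\{\{\rho\}\}_{\log}}-\frac{\{\{p^{-1}\}\}}{\{\{p^{-1}\}\}_{\log}\{\{\rho\}\}}\right)^{-1}\{\{v_x\}\},\quad f^x_{\rho v_x}=\{\{v_x\}\}f^x_\rho+\frac{\{\{\rho\}\}}{\{\{\rho/p\}\}},\quad f^x_{\rho v_y}=\{\{v_y\}\}f^x_\rho,$$ $$f^x_{\rho e}=\left(\frac{1}{\gamma-1}\frac{1}{\{\{p^{-1}\}\}_{\log}\{\{\rho\}\}}+\{\{v_x\}\}^2+\{\{v_y\}\}^2-\frac{\{\{v_x^2\}\}+\{\{v_y^2\}\}}{2}\right)f^x_\rho+\frac{\{\{\rho\}\}\{\{v_x\}\}}{\{\{\rho/p\}\}},$$ and $$f^{y}_{\rho}=(\gamma-1)\left(\frac{\gamma}{\{\{\rho\}\}_{\log}}-\frac{\{\{p^{-1}\}\}}{\{\{p^{-1}\}\}_{\log}\{\{\rho\}\}}\right)^{-1}\{\{v_y\}\},\quad f^y_{\rho v_x}=\{\{v_x\}\}f^y_\rho,\quad f^y_{\rho v_y}=\{\{v_y\}\}f^y_\rho+\frac{\{\{\rho\}\}}{\{\{\rho/p\}\}},$$ $$f^y_{\rho e}=\left(\frac{1}{\gamma-1}\frac{1}{\{\{p^{-1}\}\}_{\log}\{\{\rho\}\}}+\{\{v_x\}\}^2+\{\{v_y\}\}^2-\frac{\{\{v_x^2\}\}+\{\{v_y^2\}\}}{2}\right)f^y_\rho+\frac{\{\{\rho\}\}\{\{v_y\}\}}{\{\{\rho/p\}\}}.$$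 These fluxes are entropy conservative and consistent. Additionally, they are kinetic energy preserving with numerical pressure flux $p^{\mathrm{num}}=\{\{\rho\}\}/\{\{\rho/p\}\}$.
   Context: Euler equations: $\partial_tu+\partial_xf_x(u)+\partial_yf_y(u)=0$, $u=(\rho,\rho v_x,\rho v_y,\rho e)^T$, $f_x=(\rho v_x,\rho v_x^2+p,\rho v_xv_y,(\rho e+p)v_x)^T$, $f_y=(\rho v_y,\rho v_xv_y,\rho v_y^2+p,(\rho e+p)v_y)^T$, $p=(\gamma-1)(\rho e-\frac12\rho v^2)$, $v^2=v_x^2+v_y^2$, $\gamma>1$ the constant ratio of specific heats, $\rho,p>0$. With $s=\log(p/\rho^\gamma)$, the entropy is $U=-\rho s/(\gamma-1)$, the entropy variables are $w=U'(u)=\left(\frac{\gamma}{\gamma-1}-\frac{s}{\gamma-1}-\frac{\rho v^2}{2p},\frac{\rho v_x}{p},\frac{\rho v_y}{p},-\frac{\rho}{p}\right)^T$ and the flux potentials are $\psi_x=\rho v_x$, $\psi_y=\rho v_y$. Means of a quantity $a$ with values $a_-,a_+$ at the states $u_-,u_+$: $\{\{a\}\}=\frac{a_-+a_+}2$; for $a_\pm>0$, $\{\{a\}\}_{\log}=\frac{a_+-a_-}{\log a_+-\log a_-}$ (and $=a$ if $a_-=a_+=a$). A two-point flux $f^j=(f^j_\rho,f^j_{\rho v_x},f^j_{\rho v_y},f^j_{\rho e})^T(u_-,u_+)$, $j\in\{x,y\}$, is consistent if $f^j(u,u)=f_j(u)$; entropy conservative if $(w_+-w_-)\cdot f^j(u_-,u_+)-(\psi_{j,+}-\psi_{j,-})=0$;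 kinetic energy preserving with numerical pressure flux $p^{\mathrm{num}}$ if $f^j_{\rho v_j}=\{\{v_j\}\}f^j_\rho+p^{\mathrm{num}}$ with $p^{\mathrm{num}}$ a consistent approximation of the pressure, i.e. $p^{\mathrm{num}}(u,u)=p$.
   Formalization: Entropy conservation and the kinetic energy identity are stated only for pairs of states where the bracket inverted in the density flux is nonzero; it vanishes for some admissible pairs with a large pressure ratio, where the fluxes are undefined. *)

theory Defs
  imports "HOL-Analysis.Analysis"
begin

text \<open>
  States are vectors of conserved variables
  \<open>(\<rho>, \<rho> v\<^sub>x, \<rho> v\<^sub>y, \<rho> e)\<close>, with components 1, 2, 3, 4.
\<close>

type_synonym state = "real ^ 4"

datatype direction = X | Y

definition vec4 :: "real \<Rightarrow> real \<Rightarrow> real \<Rightarrow> real \<Rightarrow> real ^ 4" where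
  "vec4 a b c d = vector [a, b, c, d]"

lemma vec4_nth [simp]:
  "vec4 a b c d $ 1 = a" "vec4 a b c d $ 2 = b" "vec4 a b c d $ 3 = c" "vec4 a b c d $ 4 = d"
  unfolding vec4_def vector_def by simp_all

definition rho :: "state \<Rightarrow> real" where
  "rho u = u $ 1"

fun momentum_index :: "direction \<Rightarrow> 4" where
  "momentum_index X = 2"
| "momentum_index Y = 3"

definition vel :: "direction \<Rightarrow> state \<Rightarrow> real" where
  "vel j u = u $ momentum_index j / rho u"

definition energy :: "state \<Rightarrow> real" where
  "energy u = u $ 4"

definition pressure :: "real \<Rightarrow> state \<Rightarrow> real" where
  "pressure \<gamma> u = (\<gamma> - 1) * (energy u - 1 / 2 * rho u * ((vel X u)\<^sup>2 + (vel Y u)\<^sup>2))"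

definition admissible :: "real \<Rightarrow> state \<Rightarrow> bool" where
  "admissible \<gamma> u \<longleftrightarrow> rho u > 0 \<and> pressure \<gamma> u > 0"

fun euler_flux :: "real \<Rightarrow> direction \<Rightarrow> state \<Rightarrow> real ^ 4" where
  "euler_flux \<gamma> X u = vec4
     (rho u * vel X u)
     (rho u * (vel X u)\<^sup>2 + pressure \<gamma> u)
     (rho u * vel X u * vel Y u)
     ((energy u + pressure \<gamma> u) * vel X u)"
| "euler_flux \<gamma> Y u = vec4
     (rho u * vel Y u)
     (rho u * vel X u * vel Y u)
     (rho u * (vel Y u)\<^sup>2 + pressure \<gamma> u)
     ((energy u + pressure \<gamma> u) * vel Y u)"

definition spec_entropy :: "real \<Rightarrow> state \<Rightarrow> real" where
  "spec_entropy \<gamma> u = ln (pressure \<gamma> u / rho u powr \<gamma>)"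

definition entropy :: "real \<Rightarrow> state \<Rightarrow> real" where
  "entropy \<gamma> u = - (rho u * spec_entropy \<gamma> u / (\<gamma> - 1))"

text \<open>
  The explicit form of the gradient of \<^const>\<open>entropy\<close> with respect to the conserved
  variables; see \<open>entropy_vars_gradient\<close> below.
\<close>

definition entropy_vars :: "real \<Rightarrow> state \<Rightarrow> real ^ 4" where
  "entropy_vars \<gamma> u = vec4
     (\<gamma> / (\<gamma> - 1) - spec_entropy \<gamma> u / (\<gamma> - 1)
        - rho u * ((vel X u)\<^sup>2 + (vel Y u)\<^sup>2) / (2 * pressure \<gamma> u))
     (rho u * vel X u / pressure \<gamma> u)
     (rho u * vel Y u / pressure \<gamma> u)
     (- (rho u / pressure \<gamma> u))"

lemma entropy_vars_gradient:
  assumes g: "\<gamma> > 1" and "admissible \<gamma> u"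
  shows "GDERIV (entropy \<gamma>) u :> entropy_vars \<gamma> u"
proof -
  define r where "r = u $ 1"
  define m where "m = u $ 2"
  define n where "n = u $ 3"
  define p where "p = pressure \<gamma> u"
  have r: "r > 0" and p: "p > 0" using assms by (auto simp: admissible_def rho_def r_def p_def)
  have pe: "pressure \<gamma> x = (\<gamma> - 1) * (x $ 4 - 1/2 * x$1 * ((x$2 / x$1)\<^sup>2 + (x$3/x$1)\<^sup>2))" for x
    by (simp add: pressure_def energy_def rho_def vel_def)
  have dc: "((\<lambda>x::state. x $ i) has_derivative (\<lambda>h. h $ i)) (at u)" for i
    by (rule bounded_linear_imp_has_derivative) (rule bounded_linear_vec_nth)
  have d1: "(pressure \<gamma> has_derivative (\<lambda>h. (\<gamma> - 1) * (h$4 + (m\<^sup>2+n\<^sup>2)/(2*r\<^sup>2) * h$1 - m/r * h$2 - n/r*h$3))) (at u)"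
    unfolding pe[abs_def]
    apply (rule derivative_eq_intros dc refl | use r in \<open>simp add: r_def; fail\<close>)+
    apply (rule ext)
    using r by (simp add: r_def m_def n_def field_simps power2_eq_square)
  have d2: "(entropy \<gamma> has_derivative (\<lambda>h. - (h$1 * spec_entropy \<gamma> u / (\<gamma>-1)) - r/(\<gamma>-1) * ((\<gamma> - 1) * (h$4 + (m\<^sup>2+n\<^sup>2)/(2*r\<^sup>2) * h$1 - m/r * h$2 - n/r*h$3) / p - \<gamma> * h$1 / r))) (at u)"
    unfolding entropy_def[abs_def] spec_entropy_def rho_def
    apply (rule derivative_eq_intros dc d1 refl | use r p g in \<open>simp add: r_def p_def; fail\<close>)+
    apply (rule ext)
    using r p g by (simp add: r_def[symmetric] p_def[symmetric] divide_simps)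
  have "- (h1 * s / (\<gamma> - 1)) - r / (\<gamma> - 1) * ((\<gamma> - 1) * (h4 + (m\<^sup>2+n\<^sup>2)/(2*r\<^sup>2) * h1 - m/r * h2 - n/r*h3) / p - \<gamma> * h1 / r)
      = h1 * (\<gamma> / (\<gamma> - 1) - s / (\<gamma> - 1) - r * ((m / r)\<^sup>2 + (n / r)\<^sup>2) / (2 * p))
        + h2 * (r * (m / r) / p) + h3 * (r * (n / r) / p) + h4 * (- (r / p))" for h1 h2 h3 h4 s
  proof -
    define A where "A = h4 + (m\<^sup>2+n\<^sup>2)/(2*r\<^sup>2) * h1 - m/r * h2 - n/r*h3"
    have e1: "r / (\<gamma> - 1) * ((\<gamma> - 1) * A / p - \<gamma> * h1 / r) = r * A / p - \<gamma> * h1 / (\<gamma> - 1)"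
      using r p g by (simp add: right_diff_distrib)
    have e2: "r * ((m / r)\<^sup>2 + (n / r)\<^sup>2) / (2 * p) = (m\<^sup>2 + n\<^sup>2) / (2 * r * p)"
      using r p by (simp add: field_simps power2_eq_square)
    have e3: "r * A / p = h4 * (r / p) + (m\<^sup>2 + n\<^sup>2) / (2 * r * p) * h1 - m / p * h2 - n / p * h3"
      unfolding A_def using r p by (simp add: field_simps power2_eq_square)
    show ?thesis unfolding A_def[symmetric] e1 e2 unfolding e3 using r
      by (simp add: right_diff_distrib distrib_left mult.commute)
  qed
  then have "(entropy \<gamma> has_derivative (\<lambda>h. h \<bullet> entropy_vars \<gamma> u)) (at u)"
    using d2 by (simp add: inner_vec_def sum_4 entropy_vars_def rho_def vel_def
        r_def[symmetric] m_def[symmetric] n_def[symmetric] p_def[symmetric])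
  then show ?thesis
    unfolding gderiv_def .
qed

definition flux_potential :: "direction \<Rightarrow> state \<Rightarrow> real" where
  "flux_potential j u = rho u * vel j u"

definition mean :: "(state \<Rightarrow> real) \<Rightarrow> state \<Rightarrow> state \<Rightarrow> real" where
  "mean a um up = (a um + a up) / 2"

definition logmean :: "(state \<Rightarrow> real) \<Rightarrow> state \<Rightarrow> state \<Rightarrow> real" where
  "logmean a um up =
     (if a um = a up then a um else (a up - a um) / (ln (a up) - ln (a um)))"

text \<open>
  A two-point flux need not be defined for every pair of admissible states (its formula may
  contain a vanishing denominator), so the notions below refer to a domain \<open>D\<close> of pairs of
  states. A consistent flux must in particular be defined on the whole diagonal.
\<close>

type_synonym two_point_flux = "state \<Rightarrow> state \<Rightarrow> real ^ 4"

definition consistent ::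
  "real \<Rightarrow> (state \<times> state) set \<Rightarrow> direction \<Rightarrow> two_point_flux \<Rightarrow> bool" where
  "consistent \<gamma> D j f \<longleftrightarrow>
     (\<forall>u. admissible \<gamma> u \<longrightarrow> (u, u) \<in> D \<and> f u u = euler_flux \<gamma> j u)"

definition entropy_conservative ::
  "real \<Rightarrow> (state \<times> state) set \<Rightarrow> direction \<Rightarrow> two_point_flux \<Rightarrow> bool" where
  "entropy_conservative \<gamma> D j f \<longleftrightarrow>
     (\<forall>(um, up) \<in> D.
        (entropy_vars \<gamma> up - entropy_vars \<gamma> um) \<bullet> f um up
          - (flux_potential j up - flux_potential j um) = 0)"

definition kinetic_energy_preserving ::
  "real \<Rightarrow> (state \<times> state) set \<Rightarrow> direction \<Rightarrow> two_point_flux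
     \<Rightarrow> (state \<Rightarrow> state \<Rightarrow> real) \<Rightarrow> bool" where
  "kinetic_energy_preserving \<gamma> D j f pnum \<longleftrightarrow>
     (\<forall>(um, up) \<in> D.
        f um up $ momentum_index j = mean (vel j) um up * f um up $ 1 + pnum um up) \<and>
     (\<forall>u. admissible \<gamma> u \<longrightarrow> pnum u u = pressure \<gamma> u)"

definition density_bracket :: "real \<Rightarrow> state \<Rightarrow> state \<Rightarrow> real" where
  "density_bracket \<gamma> um up =
     \<gamma> / logmean rho um up
       - mean (\<lambda>u. inverse (pressure \<gamma> u)) um up
           / (logmean (\<lambda>u. inverse (pressure \<gamma> u)) um up * mean rho um up)"

text \<open>
  The inverse of \<^const>\<open>density_bracket\<close> enters the numerical fluxes, and the bracket vanishes
  at some pairs of admissible states with a large pressure ratio. There the fluxes are undefined.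
  All other denominators in the fluxes are positive at admissible states.
\<close>

definition num_flux_domain :: "real \<Rightarrow> (state \<times> state) set" where
  "num_flux_domain \<gamma> =
     {(um, up). admissible \<gamma> um \<and> admissible \<gamma> up \<and> density_bracket \<gamma> um up \<noteq> 0}"

definition num_pressure :: "real \<Rightarrow> state \<Rightarrow> state \<Rightarrow> real" where
  "num_pressure \<gamma> um up = mean rho um up / mean (\<lambda>u. rho u / pressure \<gamma> u) um up"

definition num_flux_rho :: "real \<Rightarrow> direction \<Rightarrow> state \<Rightarrow> state \<Rightarrow> real" where
  "num_flux_rho \<gamma> j um up =
     (\<gamma> - 1) * inverse (density_bracket \<gamma> um up) * mean (vel j) um up"

definition num_flux_energy :: "real \<Rightarrow> direction \<Rightarrow> state \<Rightarrow> state \<Rightarrow> real" where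
  "num_flux_energy \<gamma> j um up =
     (1 / (\<gamma> - 1) * (1 / (logmean (\<lambda>u. inverse (pressure \<gamma> u)) um up * mean rho um up))
        + (mean (vel X) um up)\<^sup>2 + (mean (vel Y) um up)\<^sup>2
        - (mean (\<lambda>u. (vel X u)\<^sup>2) um up + mean (\<lambda>u. (vel Y u)\<^sup>2) um up) / 2)
       * num_flux_rho \<gamma> j um up
     + mean rho um up * mean (vel j) um up / mean (\<lambda>u. rho u / pressure \<gamma> u) um up"

fun num_flux :: "real \<Rightarrow> direction \<Rightarrow> two_point_flux" where
  "num_flux \<gamma> X um up = vec4
     (num_flux_rho \<gamma> X um up)
     (mean (vel X) um up * num_flux_rho \<gamma> X um up
        + mean rho um up / mean (\<lambda>u. rho u / pressure \<gamma> u) um up)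
     (mean (vel Y) um up * num_flux_rho \<gamma> X um up)
     (num_flux_energy \<gamma> X um up)"
| "num_flux \<gamma> Y um up = vec4
     (num_flux_rho \<gamma> Y um up)
     (mean (vel X) um up * num_flux_rho \<gamma> Y um up)
     (mean (vel Y) um up * num_flux_rho \<gamma> Y um up
        + mean rho um up / mean (\<lambda>u. rho u / pressure \<gamma> u) um up)
     (num_flux_energy \<gamma> Y um up)"

end

theory Submission
  imports Defs
begin

text \<open>
  Write \<open>[a]\<close> for the jump and \<open>{a}\<close> for the mean of \<open>a\<close>, and let \<open>q = 1 / p\<close>.
  Since \<open>s = - ln q - \<gamma> ln \<rho>\<close>, and since a logarithmic mean \<open>L\<close> of \<open>a\<close> satisfies \<open>[ln a] L = [a]\<close>,
  every jump becomes a combination of \<open>[\<rho>]\<close>, \<open>[q]\<close> and \<open>[v\<^sub>x]\<close>, \<open>[v\<^sub>y]\<close> by the product rule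
  \<open>[a b] = {a} [b] + {b} [a]\<close>. The pressure terms and \<open>[\<rho> v]\<close> leave only \<open>- {v} [\<rho>]\<close>; the
  velocity terms multiplying the density flux cancel; and expanding \<open>[\<rho> q]\<close> cancels \<open>[q]\<close>,
  so that the density flux is determined by the coefficient of \<open>[\<rho>]\<close>.
\<close>

text \<open>The product form also covers equal values, where both sides vanish.\<close>

lemma logmean_mult_ln_diff:
  assumes "a um > 0" "a up > 0"
  shows "(ln (a up) - ln (a um)) * logmean a um up = a up - a um"
  using assms by (auto simp: logmean_def)

lemma logmean_pos:
  assumes "a um > 0" "a up > 0"
  shows "logmean a um up > 0"
  using assms by (auto simp: logmean_def zero_less_divide_iff linorder_neq_iff)

lemma spec_entropy_eq:
  assumes "admissible \<gamma> u"
  shows "spec_entropy \<gamma> u = - ln (inverse (pressure \<gamma> u)) - \<gamma> * ln (rho u)"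
  using assms by (simp add: spec_entropy_def admissible_def ln_div ln_powr ln_inverse)

lemma jump_mult:
  fixes a1 a2 b1 b2 :: real
  shows "a2 * b2 - a1 * b1 = (a1 + a2) / 2 * (b2 - b1) + (b1 + b2) / 2 * (a2 - a1)"
  by (simp add: field_simps)

text \<open>Here \<open>u\<close> is the velocity in the direction of the flux, \<open>v\<close> the transversal one.\<close>

lemma entropy_conservation_identity:
  fixes r1 r2 q1 q2 u1 u2 v1 v2 :: real
  defines "r \<equiv> (r1 + r2) / 2" and "q \<equiv> (q1 + q2) / 2"
    and "u \<equiv> (u1 + u2) / 2" and "v \<equiv> (v1 + v2) / 2"
    and "b \<equiv> (r1 * q1 + r2 * q2) / 2"
  assumes g: "\<gamma> \<noteq> 1"
    and lr: "lr * R = r2 - r1" and lq: "lq * Q = q2 - q1"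
    and nz: "R \<noteq> 0" "Q \<noteq> 0" "r \<noteq> 0"
    and k: "k * (\<gamma> / R - q / (Q * r)) = (\<gamma> - 1) * u"
    and P: "P * b = r"
  shows "((lq + \<gamma> * lr) / (\<gamma> - 1)
            - (r2 * q2 * (u2\<^sup>2 + v2\<^sup>2) - r1 * q1 * (u1\<^sup>2 + v1\<^sup>2)) / 2) * k
         + (r2 * q2 * u2 - r1 * q1 * u1) * (u * k + P)
         + (r2 * q2 * v2 - r1 * q1 * v1) * (v * k)
         - (r2 * q2 - r1 * q1) *
             ((1 / (\<gamma> - 1) * (1 / (Q * r)) + u\<^sup>2 + v\<^sup>2
                - ((u1\<^sup>2 + u2\<^sup>2) / 2 + (v1\<^sup>2 + v2\<^sup>2) / 2) / 2) * k + P * u)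
         = r2 * u2 - r1 * u1" (is "?lhs = _")
proof -
  \<comment> \<open>With \<open>q = 1 / p\<close>, \<open>k\<close> stands for the density flux,
    \<open>P\<close> for the pressure flux, \<open>R\<close> and \<open>Q\<close> for the
    logarithmic means of \<rho> and \<open>q\<close>, \<open>lr\<close> and \<open>lq\<close> for
    the jumps of their logarithms, and \<open>b\<close> for the mean of \<rho> / p, whose jump is
    \<open>J\<close>.\<close>
  define J where "J = r2 * q2 - r1 * q1"
  have J: "J = r * (q2 - q1) + q * (r2 - r1)"
    unfolding J_def r_def q_def by (rule jump_mult)
  \<comment> \<open>The factor of \<open>J\<close> equals \<open>(u1 * u2 + v1 * v2) / 2\<close>; it
    is the velocity part of the energy flux coefficient.\<close>
  have kinetic:
    "(r2 * q2 * (u2\<^sup>2 + v2\<^sup>2) - r1 * q1 * (u1\<^sup>2 + v1\<^sup>2)) / 2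
       = u * (r2 * q2 * u2 - r1 * q1 * u1) + v * (r2 * q2 * v2 - r1 * q1 * v1)
         - J * (u\<^sup>2 + v\<^sup>2 - ((u1\<^sup>2 + u2\<^sup>2) / 2 + (v1\<^sup>2 + v2\<^sup>2) / 2) / 2)"
    unfolding J_def u_def v_def by (simp add: field_simps power2_eq_square)
  have mom: "r2 * q2 * u2 - r1 * q1 * u1 = b * (u2 - u1) + u * J"
    unfolding b_def u_def J_def by (rule jump_mult)
  \<comment> \<open>The \<open>u * J\<close> part of the momentum jump cancels against the pressure
    work, and \<open>P * b = r\<close> removes \<open>b\<close>.\<close>
  have pres: "(r2 * q2 * u2 - r1 * q1 * u1) * P - J * (P * u) = r * (u2 - u1)"
    unfolding mom P[symmetric] by (simp add: algebra_simps)
  have ln_jumps: "lr = (r2 - r1) / R" "lq = (q2 - q1) / Q"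
    unfolding lr[symmetric] lq[symmetric] using nz by simp_all
  have "lq + \<gamma> * lr - J / (Q * r) = (r2 - r1) * (\<gamma> / R - q / (Q * r))"
    unfolding J ln_jumps using nz by (simp add: field_simps)
  then have "(lq + \<gamma> * lr - J / (Q * r)) * k = (r2 - r1) * (k * (\<gamma> / R - q / (Q * r)))"
    by (simp only: mult_ac)
  also have "\<dots> = (\<gamma> - 1) * (u * (r2 - r1))"
    unfolding k by (simp only: mult_ac)
  finally have dens: "(lq + \<gamma> * lr - J / (Q * r)) * k / (\<gamma> - 1) = u * (r2 - r1)"
    using g by simp
  \<comment> \<open>\<open>u * M + v * N\<close> cancels against the momentum fluxes and
    \<open>J * (K - S)\<close> against the energy flux, leaving the internal energy coefficient
    \<open>c\<close> and the pressure terms.\<close>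
  have regroup: "(A - (u * M + v * N - J * (K - S))) * k + M * (u * k + P) + N * (v * k)
      - J * ((c + K - S) * k + P * u) = (A - J * c) * k + (M * P - J * (P * u))" for A M N K S c
    by algebra
  have factor: "(A / d - J * (1 / d * (1 / e))) * k = (A - J / e) * k / d" for A d e
    by (simp add: divide_inverse algebra_simps)
  have "?lhs = ((lq + \<gamma> * lr) / (\<gamma> - 1) - J * (1 / (\<gamma> - 1) * (1 / (Q * r)))) * k
      + ((r2 * q2 * u2 - r1 * q1 * u1) * P - J * (P * u))"
    unfolding kinetic J_def[symmetric] add.assoc[of _ "u\<^sup>2" "v\<^sup>2"] by (rule regroup)
  also have "((lq + \<gamma> * lr) / (\<gamma> - 1) - J * (1 / (\<gamma> - 1) * (1 / (Q * r)))) * k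
      = (lq + \<gamma> * lr - J / (Q * r)) * k / (\<gamma> - 1)"
    by (rule factor)
  also have "(lq + \<gamma> * lr - J / (Q * r)) * k / (\<gamma> - 1)
      + ((r2 * q2 * u2 - r1 * q1 * u1) * P - J * (P * u)) = r2 * u2 - r1 * u1"
    unfolding dens pres unfolding r_def u_def by (simp add: field_simps)
  finally show ?thesis .
qed

lemma entropy_vars_nth:
  "entropy_vars \<gamma> u $ 2 = rho u * inverse (pressure \<gamma> u) * vel X u"
  "entropy_vars \<gamma> u $ 3 = rho u * inverse (pressure \<gamma> u) * vel Y u"
  "entropy_vars \<gamma> u $ 4 = - (rho u * inverse (pressure \<gamma> u))"
  by (simp_all only: entropy_vars_def vec4_nth divide_inverse mult_ac)

text \<open>The constant \<gamma> / (\<gamma> - 1) drops out of the jump, and what remains has the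
  shape of the factor of \<open>k\<close> in the identity.\<close>

lemma entropy_vars_diff_1:
  assumes "admissible \<gamma> um" "admissible \<gamma> up"
  shows "entropy_vars \<gamma> up $ 1 - entropy_vars \<gamma> um $ 1 =
      (ln (inverse (pressure \<gamma> up)) - ln (inverse (pressure \<gamma> um))
        + \<gamma> * (ln (rho up) - ln (rho um))) / (\<gamma> - 1)
      - (rho up * inverse (pressure \<gamma> up) * ((vel X up)\<^sup>2 + (vel Y up)\<^sup>2)
          - rho um * inverse (pressure \<gamma> um) * ((vel X um)\<^sup>2 + (vel Y um)\<^sup>2)) / 2"
proof -
  have *: "entropy_vars \<gamma> u $ 1 = \<gamma> / (\<gamma> - 1)
      + (ln (inverse (pressure \<gamma> u)) + \<gamma> * ln (rho u)) / (\<gamma> - 1)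
      - rho u * inverse (pressure \<gamma> u) * ((vel X u)\<^sup>2 + (vel Y u)\<^sup>2) / 2"
    if "admissible \<gamma> u" for u
  proof -
    have neg: "(- a - c) / d = - ((a + c) / d)" for a c d :: real
      using minus_divide_left[of "a + c" d] by simp
    have inv: "a * c / (2 * d) = a * inverse d * c / 2" for a c d :: real
      by (simp add: inverse_eq_divide mult.commute)
    show ?thesis
      unfolding entropy_vars_def vec4_nth spec_entropy_eq[OF that] neg inv diff_minus_eq_add
      by (rule refl)
  qed
  have regroup: "a + (b + c) - e - (a + (b' + c') - e') = b - b' + (c - c') - (e - e')"
    for a b c e b' c' e' :: real
    by simp
  show ?thesis
    unfolding *[OF assms(1)] *[OF assms(2)] right_diff_distrib add_divide_distrib diff_divide_distrib
    by (rule regroup)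
qed

lemma num_flux_energy_eq:
  "num_flux_energy \<gamma> j um up =
     (1 / (\<gamma> - 1) * (1 / (logmean (\<lambda>u. inverse (pressure \<gamma> u)) um up * mean rho um up))
        + (mean (vel X) um up)\<^sup>2 + (mean (vel Y) um up)\<^sup>2
        - (mean (\<lambda>u. (vel X u)\<^sup>2) um up + mean (\<lambda>u. (vel Y u)\<^sup>2) um up) / 2)
       * num_flux_rho \<gamma> j um up
     + num_pressure \<gamma> um up * mean (vel j) um up"
  by (simp add: num_flux_energy_def num_pressure_def)

lemma entropy_conservative_num_flux:
  assumes g: "\<gamma> > 1"
  shows "entropy_conservative \<gamma> (num_flux_domain \<gamma>) j (num_flux \<gamma> j)"
  unfolding entropy_conservative_def
proof clarify
  fix um up
  assume "(um, up) \<in> num_flux_domain \<gamma>"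
  then have am: "admissible \<gamma> um" and ap: "admissible \<gamma> up"
    and B: "density_bracket \<gamma> um up \<noteq> 0"
    by (auto simp: num_flux_domain_def)
  have pos: "rho um > 0" "rho up > 0" "pressure \<gamma> um > 0" "pressure \<gamma> up > 0"
    using am ap by (auto simp: admissible_def)
  let ?q = "\<lambda>u. inverse (pressure \<gamma> u)"
  have qpos: "?q um > 0" "?q up > 0" using pos by simp_all
  \<comment> \<open>Multiplying by the bracket undoes its inverse, as it is nonzero on the
    domain.\<close>
  have k: "num_flux_rho \<gamma> j um up
      * (\<gamma> / logmean rho um up
          - (?q um + ?q up) / 2 / (logmean ?q um up * ((rho um + rho up) / 2)))
      = (\<gamma> - 1) * ((vel j um + vel j up) / 2)"
    using B by (simp add: num_flux_rho_def density_bracket_def mean_def)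
  have beta: "mean (\<lambda>u. rho u / pressure \<gamma> u) um up
      = (rho um * ?q um + rho up * ?q up) / 2"
    by (simp only: mean_def divide_inverse)
  have "(rho um * ?q um + rho up * ?q up) / 2 \<noteq> 0"
    using pos add_pos_pos[of "rho um * ?q um" "rho up * ?q up"] by simp
  then have P: "num_pressure \<gamma> um up * ((rho um * ?q um + rho up * ?q up) / 2)
      = (rho um + rho up) / 2"
    unfolding num_pressure_def beta unfolding mean_def
    by (rule nonzero_eq_divide_eq[THEN iffD1, OF _ refl])
  have R: "logmean rho um up \<noteq> 0" and Q: "logmean ?q um up \<noteq> 0"
    using logmean_pos[of rho, OF pos(1,2)] logmean_pos[of ?q, OF qpos] by simp_all
  have r: "(rho um + rho up) / 2 \<noteq> 0" using pos by simp
  have g1: "\<gamma> \<noteq> 1" using g by simp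
  \<comment> \<open>The transversal direction \<open>i\<close> stays free, so one identity serves
    both fluxes.\<close>
  note identity = entropy_conservation_identity[where ?v1.0 = "vel i um" and ?v2.0 = "vel i up" for i, OF g1
      logmean_mult_ln_diff[of rho, OF pos(1,2)] logmean_mult_ln_diff[of ?q, OF qpos] R Q r k P]
  have regroup_X: "W * k + M * f + N * g + (- b - - a) * h - (d - c) = 0"
    if "W * k + M * f + N * g - (b - a) * h = d - c" for W k M f N g a b c d h :: real
    using that by (simp add: algebra_simps)
  \<comment> \<open>The identity lists the flux direction first, so for \<open>Y\<close> the two
    velocity components must be swapped.\<close>
  have regroup_Y: "(A - (b * (V2 + U2) - a * (V1 + U1)) / 2) * k + N * g + M * f
        + (- b - - a) * ((C + V + U - (T + S) / 2) * k + h) - (d - c) = 0"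
    if "(A - (b * (U2 + V2) - a * (U1 + V1)) / 2) * k + M * f + N * g
        - (b - a) * ((C + U + V - (S + T) / 2) * k + h) = d - c"
    for A U1 U2 V1 V2 U V S T C k M f N g a b c d h :: real
    using that by (simp add: algebra_simps add_divide_distrib diff_divide_distrib)
  show "(entropy_vars \<gamma> up - entropy_vars \<gamma> um) \<bullet> num_flux \<gamma> j um up
      - (flux_potential j up - flux_potential j um) = 0"
  proof (cases j)
    case X
    show ?thesis
      unfolding X inner_vec_def sum_4 vector_minus_component inner_real_def
        entropy_vars_diff_1[OF am ap] entropy_vars_nth num_flux.simps vec4_nth
        num_flux_energy_eq num_pressure_def[symmetric]
      unfolding flux_potential_def mean_def
      by (rule regroup_X[OF identity[of Y, unfolded X]])
  next
    case Y
    show ?thesis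
      unfolding Y inner_vec_def sum_4 vector_minus_component inner_real_def
        entropy_vars_diff_1[OF am ap] entropy_vars_nth num_flux.simps vec4_nth
        num_flux_energy_eq num_pressure_def[symmetric]
      unfolding flux_potential_def mean_def
      by (rule regroup_Y[OF identity[of X, unfolded Y]])
  qed
qed

lemma mean_diag [simp]: "mean a u u = a u"
  by (simp add: mean_def)

lemma logmean_diag [simp]: "logmean a u u = a u"
  by (simp add: logmean_def)

text \<open>Both means of 1 / p agree and cancel, leaving \<gamma> / \<rho> - 1 / \<rho>. For
  \<gamma> > 1 this is nonzero, which puts the diagonal into the domain.\<close>

lemma density_bracket_diag:
  assumes "admissible \<gamma> u"
  shows "density_bracket \<gamma> u u = (\<gamma> - 1) / rho u"
  using assms by (simp add: density_bracket_def admissible_def diff_divide_distrib)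

lemma num_pressure_diag:
  assumes "admissible \<gamma> u"
  shows "num_pressure \<gamma> u u = pressure \<gamma> u"
  using assms by (simp add: num_pressure_def admissible_def)

lemma num_flux_rho_diag:
  assumes "\<gamma> > 1" "admissible \<gamma> u"
  shows "num_flux_rho \<gamma> j u u = rho u * vel j u"
  using assms by (simp add: num_flux_rho_def density_bracket_diag)

lemma energy_eq:
  assumes "\<gamma> > 1"
  shows "energy u = pressure \<gamma> u / (\<gamma> - 1) + rho u * ((vel X u)\<^sup>2 + (vel Y u)\<^sup>2) / 2"
  using assms by (simp add: pressure_def)

text \<open>At equal states the coefficient of the density flux becomes p / ((\<gamma> - 1) \<rho>)
  plus half the squared speed, which is the specific total energy.\<close>

lemma num_flux_energy_diag:
  assumes "\<gamma> > 1" "admissible \<gamma> u"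
  shows "num_flux_energy \<gamma> j u u = (energy u + pressure \<gamma> u) * vel j u"
proof -
  have "rho u > 0" "pressure \<gamma> u > 0" using assms by (auto simp: admissible_def)
  then show ?thesis
    using assms(1)
    by (simp add: num_flux_energy_def num_flux_rho_diag[OF assms] energy_eq[OF assms(1), of u]
        field_simps)
qed

lemma consistent_num_flux:
  assumes g: "\<gamma> > 1"
  shows "consistent \<gamma> (num_flux_domain \<gamma>) j (num_flux \<gamma> j)"
  unfolding consistent_def
proof (intro allI impI conjI)
  fix u assume a: "admissible \<gamma> u"
  then show "(u, u) \<in> num_flux_domain \<gamma>"
    using g by (auto simp: num_flux_domain_def density_bracket_diag admissible_def)
  show "num_flux \<gamma> j u u = euler_flux \<gamma> j u"
    using num_pressure_diag[OF a]
    by (cases j) (simp_all add: num_flux_rho_diag[OF g a] num_flux_energy_diag[OF g a]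
        num_pressure_def power2_eq_square mult_ac)
qed

lemma kinetic_energy_preserving_num_flux:
  "kinetic_energy_preserving \<gamma> (num_flux_domain \<gamma>) j (num_flux \<gamma> j) (num_pressure \<gamma>)"
  by (cases j) (auto simp: kinetic_energy_preserving_def num_pressure_diag, simp_all add: num_pressure_def)

theorem mainTheorem4:
  fixes \<gamma> :: real
  assumes "\<gamma> > 1"
  shows "\<forall>j. entropy_conservative \<gamma> (num_flux_domain \<gamma>) j (num_flux \<gamma> j)
           \<and> consistent \<gamma> (num_flux_domain \<gamma>) j (num_flux \<gamma> j)
           \<and> kinetic_energy_preserving \<gamma> (num_flux_domain \<gamma>) j (num_flux \<gamma> j) (num_pressure \<gamma>)"
  using entropy_conservative_num_flux[OF assms] consistent_num_flux[OF assms]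
    kinetic_energy_preserving_num_flux by blast

end
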